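(* Let $g$ be a nonnegative integer and $s$ be a positive integer. Let $\mathscr{C}_{g,\ge m}^{(s)}$ denote the set of compositions $\kappa$ in $\mathscr{C}_g^{(s)}$ such that $\kappa_1\ge m$ (the empty composition being included), and let $$C_g^{(s)}(x,q):=\sum_{\kappa\in\mathscr{C}_g^{(s)}}x^{\ell(\kappa)}q^{|\kappa|},\qquad C_{g,\ge m}^{(s)}(x,q):=\sum_{\kappa\in\mathscr{C}_{g,\ge m}^{(s)}}x^{\ell(\kappa)}q^{|\kappa|}.$$ Then for each positive integer $m$, $$C_{g,\ge m}^{(s)}(x,q)=\frac{P_{g,\le m-1}^{(s)}(-x,q)}{P_g^{(s)}(-x,q)},$$ and in particular, $$C_g^{(s)}(x,q)=\frac{1}{P_g^{(s)}(-x,q)}.$$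
   Context: All generating functions are formal power series in $x$ and $q$. A partition $\lambda=(\lambda_1,\ldots,\lambda_{\ell(\lambda)})$ is a nondecreasing finite sequence of positive integers $\lambda_1\le\cdots\le\lambda_{\ell(\lambda)}$; $|\lambda|$ is the sum of its parts and $\ell(\lambda)$ its number of parts. A composition $\kappa=(\kappa_1,\ldots,\kappa_{\ell(\kappa)})$ is a finite sequence of positive integers (in any order), with $|\kappa|$ the sum and $\ell(\kappa)$ the number of its parts. The empty sequence $\emptyset$ is allowed as a partition and as a composition. For a nonnegative integer $g$ and a positive integer $s$: $\mathscr{P}_g^{(s)}$ is the set of partitions $\lambda$ with all parts at least $s$ and $\lambda_{i+1}-\lambda_i\ge g$ for all $1\le i\le\ell(\lambda)-1$; $\mathscr{C}_g^{(s)}$ is the set of compositions $\kappa$ with all parts at least $s$ and $\kappa_{i+1}-\kappa_i\ge -(g-1)$ for all $1\le i\le\ell(\kappa)-1$. For a nonnegative integer $m$, $\mathscr{P}_{g,\le m}^{(s)}$ is the set of $\lambda\in\mathscr{P}_g^{(s)}$ whose largest part satisfies $\lambda_{\ell(\lambda)}\le m$. All of these sets contain the empty sequence. Finally, $$P_g^{(s)}(x,q):=\sum_{\lambda\in\mathscr{P}_g^{(s)}}x^{\ell(\lambda)}q^{|\lambda|},\qquad P_{g,\le m}^{(s)}(x,q):=\sum_{\lambda\in\mathscr{P}_{g,\le m}^{(s)}}x^{\ell(\lambda)}q^{|\lambda|}.$$ *)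

theory Defs
  imports "HOL-Computational_Algebra.Computational_Algebra"
begin

definition composition :: "nat list \<Rightarrow> bool" where
  "composition \<kappa> \<longleftrightarrow> (\<forall>k\<in>set \<kappa>. 0 < k)"

definition partition :: "nat list \<Rightarrow> bool" where
  "partition \<mu> \<longleftrightarrow> (\<forall>k\<in>set \<mu>. 0 < k) \<and> sorted \<mu>"

text \<open>Differences of consecutive parts are taken in \<^typ>\<open>int\<close>, as they and the bound
  \<open>-(g - 1)\<close> may be negative.\<close>

definition gap_partitions :: "nat \<Rightarrow> nat \<Rightarrow> nat list set" where
  "gap_partitions g s = {\<mu>. partition \<mu> \<and> (\<forall>k\<in>set \<mu>. s \<le> k) \<and>
     (\<forall>i. Suc i < length \<mu> \<longrightarrow> int (\<mu> ! Suc i) - int (\<mu> ! i) \<ge> int g)}"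

definition gap_compositions :: "nat \<Rightarrow> nat \<Rightarrow> nat list set" where
  "gap_compositions g s = {\<kappa>. composition \<kappa> \<and> (\<forall>k\<in>set \<kappa>. s \<le> k) \<and>
     (\<forall>i. Suc i < length \<kappa> \<longrightarrow> int (\<kappa> ! Suc i) - int (\<kappa> ! i) \<ge> - (int g - 1))}"

definition gap_partitions_le :: "nat \<Rightarrow> nat \<Rightarrow> nat \<Rightarrow> nat list set" where
  "gap_partitions_le g s m = {\<mu> \<in> gap_partitions g s. \<mu> \<noteq> [] \<longrightarrow> last \<mu> \<le> m}"

definition gap_compositions_ge :: "nat \<Rightarrow> nat \<Rightarrow> nat \<Rightarrow> nat list set" where
  "gap_compositions_ge g s m = {\<kappa> \<in> gap_compositions g s. \<kappa> \<noteq> [] \<longrightarrow> m \<le> hd \<kappa>}"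

text \<open>The series \<open>\<Sum>\<^bsub>\<kappa> \<in> S\<^esub> z\<^bsup>length \<kappa>\<^esup> q\<^bsup>|\<kappa>|\<^esup>\<close>, as a power series in \<open>q\<close> whose
  coefficients are power series in \<open>x\<close>: the outer \<open>fps\<close> is in \<open>q\<close>, the inner one in \<open>x\<close>.
  The argument \<open>z\<close> is the series put in place of \<open>x\<close>, namely \<open>x\<close> itself (\<open>fps_X\<close>)
  or \<open>-x\<close> (\<open>- fps_X\<close>).
  For sets of lists of positive integers each coefficient is a finite sum.
  Coefficients are rational because division of library power series needs an inverse
  on the coefficients.\<close>

definition gen_fun :: "nat list set \<Rightarrow> rat fps \<Rightarrow> rat fps fps" where
  "gen_fun S z = Abs_fps (\<lambda>n. \<Sum>\<kappa> | \<kappa> \<in> S \<and> sum_list \<kappa> = n. z ^ length \<kappa>)"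

definition P_series :: "nat \<Rightarrow> nat \<Rightarrow> rat fps \<Rightarrow> rat fps fps" where
  "P_series g s z = gen_fun (gap_partitions g s) z"

definition P_le_series :: "nat \<Rightarrow> nat \<Rightarrow> nat \<Rightarrow> rat fps \<Rightarrow> rat fps fps" where
  "P_le_series g s m z = gen_fun (gap_partitions_le g s m) z"

definition C_series :: "nat \<Rightarrow> nat \<Rightarrow> rat fps \<Rightarrow> rat fps fps" where
  "C_series g s z = gen_fun (gap_compositions g s) z"

definition C_ge_series :: "nat \<Rightarrow> nat \<Rightarrow> nat \<Rightarrow> rat fps \<Rightarrow> rat fps fps" where
  "C_ge_series g s m z = gen_fun (gap_compositions_ge g s m) z"

lemma composition_length_le: "composition \<kappa> \<Longrightarrow> length \<kappa> \<le> sum_list \<kappa>"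
  by (induction \<kappa>) (auto simp: composition_def)

lemma finite_compositions_of:
  assumes "\<And>\<kappa>. \<kappa> \<in> S \<Longrightarrow> composition \<kappa>"
  shows "finite {\<kappa> \<in> S. sum_list \<kappa> = n}"
proof (rule finite_subset)
  show "{\<kappa> \<in> S. sum_list \<kappa> = n} \<subseteq> {\<kappa>. set \<kappa> \<subseteq> {..n} \<and> length \<kappa> \<le> n}"
    using assms by (auto dest: composition_length_le member_le_sum_list)
  show "finite {\<kappa>. set \<kappa> \<subseteq> {..n} \<and> length \<kappa> \<le> n}"
    by (rule finite_lists_length_le) simp
qed

lemma gap_sets_compositions:
  "\<mu> \<in> gap_partitions g s \<Longrightarrow> composition \<mu>"
  "\<mu> \<in> gap_partitions_le g s m \<Longrightarrow> composition \<mu>"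
  "\<kappa> \<in> gap_compositions g s \<Longrightarrow> composition \<kappa>"
  "\<kappa> \<in> gap_compositions_ge g s m \<Longrightarrow> composition \<kappa>"
  by (auto simp: gap_partitions_def gap_partitions_le_def gap_compositions_def
      gap_compositions_ge_def partition_def composition_def)

lemma gen_fun_coeff:
  assumes "\<And>\<kappa>. \<kappa> \<in> S \<Longrightarrow> composition \<kappa>"
  shows "gen_fun S fps_X $ n $ k = of_nat (card {\<kappa> \<in> S. length \<kappa> = k \<and> sum_list \<kappa> = n})"
proof -
  have "gen_fun S fps_X $ n $ k =
      (\<Sum>\<kappa> | \<kappa> \<in> S \<and> sum_list \<kappa> = n. if length \<kappa> = k then 1 else 0)"
    by (auto simp: gen_fun_def fps_sum_nth intro!: sum.cong)
  also have "\<dots> = (\<Sum>\<kappa> \<in> {\<kappa> \<in> {\<kappa> \<in> S. sum_list \<kappa> = n}. length \<kappa> = k}. 1)"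
    by (rule sum.inter_filter[symmetric]) (rule finite_compositions_of[OF assms])
  also have "{\<kappa> \<in> {\<kappa> \<in> S. sum_list \<kappa> = n}. length \<kappa> = k} =
      {\<kappa> \<in> S. length \<kappa> = k \<and> sum_list \<kappa> = n}"
    by auto
  finally show ?thesis by simp
qed

lemma P_series_nth_0: "P_series g s z $ 0 = 1"
proof -
  have "\<kappa> = []" if "\<kappa> \<in> gap_partitions g s" "sum_list \<kappa> = 0" for \<kappa>
    using composition_length_le[OF gap_sets_compositions(1)[OF that(1)]] that(2) by simp
  moreover have "[] \<in> gap_partitions g s"
    by (simp add: gap_partitions_def partition_def)
  ultimately have "{\<kappa> \<in> gap_partitions g s. sum_list \<kappa> = 0} = {[]}"
    by auto
  then show ?thesis by (simp add: P_series_def gen_fun_def)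
qed

text \<open>The denominators are units, so division by them is multiplication by the reciprocal.\<close>

lemma P_series_inverse: "P_series g s z * inverse (P_series g s z) = 1"
  unfolding fps_inverse_def[of "P_series g s z"]
  by (rule fps_right_inverse) (simp add: P_series_nth_0)

lemma divide_P_series: "f / P_series g s z = f * inverse (P_series g s z)"
  by (simp add: fps_divide_unit P_series_nth_0)

end

theory Submission
  imports Defs
begin

text \<open>Multiplying out, the theorem says that
  \<open>C\<^bsub>\<ge>m\<^esub>(x, q) P(-x, q) = P\<^bsub>\<le>m-1\<^esub>(-x, q)\<close>. The left side sums over pairs of a gap
  composition \<open>\<kappa>\<close> and a gap partition \<open>\<mu>\<close>; write \<open>\<mu>\<close> backwards and form the word \<open>w\<close> consisting
  of \<open>\<kappa>\<close> followed by the reversed \<open>\<mu>\<close>. Let \<open>R a b\<close> be the relation \<open>b + g \<le> a\<close>. Consecutive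
  parts of a reversed gap partition always satisfy \<open>R\<close>, and consecutive parts of a gap composition
  never do. So, for a fixed word \<open>w\<close>, one has to add up the ways of cutting \<open>w\<close> into an initial
  segment without any \<open>R\<close>-step and a final segment with only \<open>R\<close>-steps, the sign being given by the
  parity of the length of the final segment. If \<open>R\<close> holds across a valid cut, then the cut can be
  moved back by one letter, otherwise forward by one letter, and the new cut is valid with the
  opposite sign; at either end of the word only the inward move is possible. Hence
  the cuts cancel in pairs, unless the cut stands in front of a word with only \<open>R\<close>-steps and there
  is no letter to move across it: the word is empty, or the condition \<open>\<kappa>\<^sub>1 \<ge> m\<close> forbids its
  first letter to start a composition. These words are the reversed gap partitions with
  largest part less than \<open>m\<close>.

  The cancellation holds for every relation (\<open>cut_sum_after_letter\<close>, \<open>cut_sum\<close>) and is an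
  induction on the word. \<open>gen_fun_mult_nth\<close> turns products of generating functions into sums over
  the cuts of words.\<close>

section \<open>Cancellation over the cuts of a word\<close>

lemma sum_cuts_Cons:
  "(\<Sum>k\<le>length (b # w). f (take k (b # w)) (drop k (b # w))) =
     f [] (b # w) + (\<Sum>k\<le>length w. f (b # take k w) (drop k w))"
  by (simp add: sum.atMost_Suc_shift del: sum.atMost_Suc)

text \<open>Keeping a letter \<open>a\<close> in front of the word lets the induction see the step across the cut:
  for a word \<open>b # w\<close> the cut in front of \<open>b\<close> is cancelled by the later ones precisely when
  \<open>\<not> R a b\<close>.\<close>

lemma cut_sum_after_letter:
  fixes z :: "'b::comm_ring_1"
  shows "(\<Sum>k\<le>length w.
            if successively (\<lambda>a b. \<not> R a b) (a # take k w) \<and> successively R (drop k w)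
            then z ^ length (take k w) * (- z) ^ length (drop k w) else 0) =
         (if successively R (a # w) then (- z) ^ length w else 0)"
proof (induction w arbitrary: a)
  case Nil
  then show ?case by simp
next
  case (Cons b w)
  have "(\<Sum>k\<le>length w.
            if successively (\<lambda>a b. \<not> R a b) (a # b # take k w) \<and> successively R (drop k w)
            then z ^ length (b # take k w) * (- z) ^ length (drop k w) else 0) =
        (if R a b then 0 else z * (\<Sum>k\<le>length w.
            if successively (\<lambda>a b. \<not> R a b) (b # take k w) \<and> successively R (drop k w)
            then z ^ length (take k w) * (- z) ^ length (drop k w) else 0))"
    by (auto simp: sum_distrib_left mult.assoc intro!: sum.cong)
  also have "\<dots> = (if R a b \<or> \<not> successively R (b # w) then 0 else z * (- z) ^ length w)"
    by (simp only: Cons.IH) simp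
  finally show ?case
    by (subst sum_cuts_Cons) simp
qed

text \<open>All nonempty initial segments have the same first letter. So \<open>Q\<close> removes either all of
  them, leaving only the cut in front of the word, or none, and then that cut is cancelled by the
  others, by \<open>cut_sum_after_letter\<close>.\<close>

lemma cut_sum:
  fixes z :: "'b::comm_ring_1"
  shows "(\<Sum>k\<le>length w.
            if (successively (\<lambda>a b. \<not> R a b) (take k w) \<and> (take k w \<noteq> [] \<longrightarrow> Q (hd (take k w))))
               \<and> successively R (drop k w)
            then z ^ length (take k w) * (- z) ^ length (drop k w) else 0) =
         (if successively R w \<and> (w \<noteq> [] \<longrightarrow> \<not> Q (hd w)) then (- z) ^ length w else 0)"
proof (cases w)
  case Nil
  then show ?thesis by simp
next
  case (Cons a v)
  have "(\<Sum>k\<le>length v.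
            if (successively (\<lambda>a b. \<not> R a b) (a # take k v)
                \<and> (a # take k v \<noteq> [] \<longrightarrow> Q (hd (a # take k v)))) \<and> successively R (drop k v)
            then z ^ length (a # take k v) * (- z) ^ length (drop k v) else 0) =
        (if Q a then z * (\<Sum>k\<le>length v.
            if successively (\<lambda>a b. \<not> R a b) (a # take k v) \<and> successively R (drop k v)
            then z ^ length (take k v) * (- z) ^ length (drop k v) else 0) else 0)"
    by (auto simp: sum_distrib_left mult.assoc intro!: sum.cong)
  also have "\<dots> = (if Q a \<and> successively R (a # v) then z * (- z) ^ length v else 0)"
    by (simp only: cut_sum_after_letter) simp
  finally show ?thesis
    unfolding Cons by (subst sum_cuts_Cons) simp
qed

section \<open>Generating functions of words\<close>

lemma composition_append: "composition (u @ v) \<longleftrightarrow> composition u \<and> composition v"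
  by (auto simp: composition_def)

text \<open>A pair \<open>(u, v)\<close> is the same as the word \<open>u @ v\<close> with a cut after \<open>length u\<close> letters. Grouping
  the terms of the product by their word, and not by the pair, makes the cancellation
  visible.\<close>

lemma gen_fun_mult_nth:
  assumes A: "\<And>u. u \<in> A \<Longrightarrow> composition u" and B: "\<And>v. v \<in> B \<Longrightarrow> composition v"
  shows "(gen_fun A y * gen_fun B z) $ n =
    (\<Sum>w | composition w \<and> sum_list w = n. \<Sum>k\<le>length w.
       if take k w \<in> A \<and> drop k w \<in> B
       then y ^ length (take k w) * z ^ length (drop k w) else 0)"
proof -
  have finA: "finite {u \<in> A. sum_list u = i}" and finB: "finite {v \<in> B. sum_list v = i}"
    and finW: "finite {w. composition w \<and> sum_list w = i}" for i
    using finite_compositions_of[of A i] finite_compositions_of[of B i]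
      finite_compositions_of[of "{w. composition w}" i] A B by auto
  have "(gen_fun A y * gen_fun B z) $ n =
      (\<Sum>i\<in>{0..n}. \<Sum>(u, v)\<in>{u \<in> A. sum_list u = i} \<times> {v \<in> B. sum_list v = n - i}.
         y ^ length u * z ^ length v)"
    by (simp add: gen_fun_def fps_mult_nth sum_product sum.cartesian_product)
  also have "\<dots> = (\<Sum>(i, u, v)\<in>(SIGMA i:{0..n}.
        {u \<in> A. sum_list u = i} \<times> {v \<in> B. sum_list v = n - i}). y ^ length u * z ^ length v)"
    using finA finB by (subst sum.Sigma) auto
  also have "\<dots> = (\<Sum>(w, k)\<in>(SIGMA w:{w. composition w \<and> sum_list w = n}.
        {k \<in> {..length w}. take k w \<in> A \<and> drop k w \<in> B}).
        y ^ length (take k w) * z ^ length (drop k w))"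
  proof (rule sum.reindex_bij_witness
      [where i = "\<lambda>(w, k). (sum_list (take k w), take k w, drop k w)"
         and j = "\<lambda>(i, u, v). (u @ v, length u)"], goal_cases)
    case (4 b)
    have "sum_list (take k w) + sum_list (drop k w) = sum_list w" for k and w :: "nat list"
      by (metis append_take_drop_id sum_list_append)
    then show ?case using 4 by (auto simp: add_implies_diff) (metis le_add1, metis diff_add_inverse)
  qed (use A B in \<open>auto simp: composition_append\<close>)
  also have "\<dots> = (\<Sum>w | composition w \<and> sum_list w = n.
      \<Sum>k\<in>{k \<in> {..length w}. take k w \<in> A \<and> drop k w \<in> B}.
        y ^ length (take k w) * z ^ length (drop k w))"
    using finW by (subst sum.Sigma) auto
  also have "\<dots> = (\<Sum>w | composition w \<and> sum_list w = n. \<Sum>k\<le>length w.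
       if take k w \<in> A \<and> drop k w \<in> B
       then y ^ length (take k w) * z ^ length (drop k w) else 0)"
    by (intro sum.cong refl sum.inter_filter finite_atMost)
  finally show ?thesis .
qed

lemma gen_fun_rev: "gen_fun (rev ` S) z = gen_fun S z"
proof -
  have "(\<Sum>\<kappa> | \<kappa> \<in> rev ` S \<and> sum_list \<kappa> = n. z ^ length \<kappa>) =
        (\<Sum>\<kappa> | \<kappa> \<in> S \<and> sum_list \<kappa> = n. z ^ length \<kappa>)" for n
    by (rule sum.reindex_bij_witness[where i = rev and j = rev]) auto
  then show ?thesis by (simp add: gen_fun_def)
qed

section \<open>Gap conditions as conditions on neighbouring letters\<close>

lemma gap_compositions_ge_iff:
  assumes "0 < s"
  shows "\<kappa> \<in> gap_compositions_ge g s m \<longleftrightarrow>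
    (\<forall>k\<in>set \<kappa>. s \<le> k) \<and> successively (\<lambda>a b. \<not> b + g \<le> a) \<kappa> \<and> (\<kappa> \<noteq> [] \<longrightarrow> m \<le> hd \<kappa>)"
proof -
  have "int a - int b \<ge> - (int g - 1) \<longleftrightarrow> \<not> a + g \<le> b" for a b
    by linarith
  moreover have "composition \<kappa>" if "\<forall>k\<in>set \<kappa>. s \<le> k"
    using assms that by (auto simp: composition_def)
  ultimately show ?thesis
    unfolding gap_compositions_ge_def gap_compositions_def successively_conv_nth by auto
qed

lemma rev_gap_partitions_iff:
  assumes "0 < s"
  shows "v \<in> rev ` gap_partitions g s \<longleftrightarrow>
    (\<forall>k\<in>set v. s \<le> k) \<and> successively (\<lambda>a b. b + g \<le> a) v"
proof -
  have "v \<in> rev ` gap_partitions g s \<longleftrightarrow> rev v \<in> gap_partitions g s"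
    by (metis image_iff rev_rev_ident)
  also have "\<dots> \<longleftrightarrow> (\<forall>k\<in>set v. s \<le> k) \<and> successively (\<lambda>a b. a + g \<le> b) (rev v)"
    using assms unfolding gap_partitions_def partition_def successively_conv_nth
      sorted_iff_nth_Suc by (fastforce simp: zle_int)
  finally show ?thesis by simp
qed

lemma rev_gap_partitions_le_iff:
  assumes "0 < s"
  shows "v \<in> rev ` gap_partitions_le g s m \<longleftrightarrow>
    (\<forall>k\<in>set v. s \<le> k) \<and> successively (\<lambda>a b. b + g \<le> a) v \<and> (v \<noteq> [] \<longrightarrow> hd v \<le> m)"
proof -
  have "v \<in> rev ` gap_partitions_le g s m \<longleftrightarrow>
      v \<in> rev ` gap_partitions g s \<and> (v \<noteq> [] \<longrightarrow> hd v \<le> m)"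
    by (auto simp: gap_partitions_le_def hd_rev image_iff)
  then show ?thesis by (simp add: rev_gap_partitions_iff[OF assms])
qed

section \<open>The product formula\<close>

lemma C_ge_series_mult_P_series:
  assumes "0 < s" "0 < m"
  shows "C_ge_series g s m z * P_series g s (- z) = P_le_series g s (m - 1) (- z)"
proof (rule fps_ext)
  fix n
  let ?R = "\<lambda>a b. b + g \<le> a"
  let ?W = "{w. composition w \<and> sum_list w = n}"
  have fin: "finite ?W"
    using finite_compositions_of[of "{w. composition w}" n] by auto
  have "(C_ge_series g s m z * P_series g s (- z)) $ n =
      (\<Sum>w\<in>?W. \<Sum>k\<le>length w.
        if take k w \<in> gap_compositions_ge g s m \<and> drop k w \<in> rev ` gap_partitions g s
        then z ^ length (take k w) * (- z) ^ length (drop k w) else 0)"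
    unfolding C_ge_series_def P_series_def gen_fun_rev[of "gap_partitions g s", symmetric]
    by (rule gen_fun_mult_nth)
       (auto dest: gap_sets_compositions simp: composition_def)
  also have "\<dots> = (\<Sum>w\<in>?W. if w \<in> rev ` gap_partitions_le g s (m - 1)
                             then (- z) ^ length w else 0)"
  proof (rule sum.cong[OF refl])
    fix w
    have parts: "(\<forall>j\<in>set w. s \<le> j) \<longleftrightarrow> (\<forall>j\<in>set (take k w). s \<le> j) \<and> (\<forall>j\<in>set (drop k w). s \<le> j)"
      for k
    proof -
      have "set w = set (take k w) \<union> set (drop k w)"
        by (metis append_take_drop_id set_append)
      then show ?thesis by blast
    qed
    \<comment> \<open>The bound \<open>s\<close> on the parts concerns the letters of \<open>w\<close> only, and is the same for all cuts.\<close>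
    have "(\<Sum>k\<le>length w.
        if take k w \<in> gap_compositions_ge g s m \<and> drop k w \<in> rev ` gap_partitions g s
        then z ^ length (take k w) * (- z) ^ length (drop k w) else 0) =
      (if \<forall>j\<in>set w. s \<le> j then \<Sum>k\<le>length w.
            if (successively (\<lambda>a b. \<not> ?R a b) (take k w) \<and> (take k w \<noteq> [] \<longrightarrow> m \<le> hd (take k w)))
               \<and> successively ?R (drop k w)
            then z ^ length (take k w) * (- z) ^ length (drop k w) else 0 else 0)"
    proof (cases "\<forall>j\<in>set w. s \<le> j")
      case True
      then have "(\<forall>j\<in>set (take k w). s \<le> j) \<and> (\<forall>j\<in>set (drop k w). s \<le> j)" for k
        using parts by blast
      then show ?thesis
        unfolding gap_compositions_ge_iff[OF assms(1)] rev_gap_partitions_iff[OF assms(1)] if_P[OF True]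
        by (intro sum.cong refl if_cong) blast+
    next
      case False
      then have "\<not> ((\<forall>j\<in>set (take k w). s \<le> j) \<and> (\<forall>j\<in>set (drop k w). s \<le> j))" for k
        using parts by blast
      then show ?thesis
        unfolding gap_compositions_ge_iff[OF assms(1)] rev_gap_partitions_iff[OF assms(1)] if_not_P[OF False]
        by (intro sum.neutral ballI if_not_P) blast
    qed
    also have "\<dots> = (if w \<in> rev ` gap_partitions_le g s (m - 1) then (- z) ^ length w else 0)"
      unfolding cut_sum[of ?R w "\<lambda>a. m \<le> a" z] rev_gap_partitions_le_iff[OF assms(1)] using assms(2) by auto
    finally show "(\<Sum>k\<le>length w.
        if take k w \<in> gap_compositions_ge g s m \<and> drop k w \<in> rev ` gap_partitions g s
        then z ^ length (take k w) * (- z) ^ length (drop k w) else 0) =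
        (if w \<in> rev ` gap_partitions_le g s (m - 1) then (- z) ^ length w else 0)" .
  qed
  also have "\<dots> = (\<Sum>w | w \<in> rev ` gap_partitions_le g s (m - 1) \<and> sum_list w = n. (- z) ^ length w)"
    unfolding sum.inter_filter[OF fin, symmetric]
    by (rule sum.cong) (auto dest: gap_sets_compositions simp: composition_def)
  also have "\<dots> = P_le_series g s (m - 1) (- z) $ n"
    unfolding P_le_series_def gen_fun_rev[of "gap_partitions_le g s (m - 1)", symmetric]
    by (simp add: gen_fun_def)
  finally show "(C_ge_series g s m z * P_series g s (- z)) $ n = P_le_series g s (m - 1) (- z) $ n" .
qed

lemma C_ge_series_1: "C_ge_series g s 1 z = C_series g s z"
proof -
  have "gap_compositions_ge g s 1 = gap_compositions g s"
    by (auto simp: gap_compositions_ge_def gap_compositions_def composition_def Suc_le_eq)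
  then show ?thesis by (simp add: C_ge_series_def C_series_def)
qed

lemma P_le_series_0: "P_le_series g s 0 z = 1"
proof -
  have "gap_partitions_le g s 0 = {[]}"
    by (auto simp: gap_partitions_le_def gap_partitions_def partition_def)
       (metis last_in_set less_numeral_extra(3))
  moreover have "{\<kappa>. \<kappa> = [] \<and> sum_list \<kappa> = n} = (if n = 0 then {[]} else {})" for n :: nat
    by auto
  ultimately show ?thesis
    by (auto simp: P_le_series_def gen_fun_def fps_eq_iff)
qed

theorem theorem2p2:
  fixes g s :: nat
  assumes "0 < s"
  shows "(\<forall>m::nat. 0 < m \<longrightarrow>
           C_ge_series g s m fps_X = P_le_series g s (m - 1) (- fps_X) / P_series g s (- fps_X))
       \<and> C_series g s fps_X = 1 / P_series g s (- fps_X)"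
proof -
  have quotient: "C_ge_series g s m fps_X = P_le_series g s (m - 1) (- fps_X) / P_series g s (- fps_X)"
    if "0 < m" for m
    unfolding divide_P_series C_ge_series_mult_P_series[OF assms that, symmetric] mult.assoc
    by (simp add: P_series_inverse)
  from quotient[of 1] have "C_series g s fps_X = 1 / P_series g s (- fps_X)"
    by (simp only: C_ge_series_1 P_le_series_0 diff_self_eq_0 zero_less_one simp_thms)
  with quotient show ?thesis by blast
qed

end
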